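(* Let $f=(f_1,\ldots,f_m)\colon\mathbb{R}^n\to\mathbb{R}^m$ be a polynomial map. Assume that there exists $\bar t\in f(\mathbb{R}^n)$ such that the section $[f(\mathbb{R}^n)]_{\bar t}$ is bounded. Then the following statements are equivalent: (i) $f$ is proper at the sublevel $\bar t$; (ii) $f$ satisfies the Palais--Smale condition at the sublevel $\bar t$: $\widetilde K_{\infty,\le\bar t}(f)=\emptyset$; (iii) $f$ satisfies the weak Palais--Smale condition at the sublevel $\bar t$: $K_{\infty,\le\bar t}(f)=\emptyset$; (iv) $f$ is $M$-tame at the sublevel $\bar t$: $T_{\infty,\le\bar t}(f)=\emptyset$. Furthermore, the set $[f(\mathbb{R}^n)]_{\bar t}$ is closed provided that one of the equivalent conditions (i), (ii), (iii), (iv) is satisfied.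
   Context: $n,m\ge1$; $\mathbb{R}^m_+$ is the nonnegative orthant; for $s,t\in\mathbb{R}^m$, $s\le t$ means $t-s\in\mathbb{R}^m_+$. For $A\subset\mathbb{R}^m$ and $\bar t\in\mathbb{R}^m$, the section of $A$ at $\bar t$ is $[A]_{\bar t}:=A\cap(\bar t-\mathbb{R}^m_+)$. It is called bounded if there is $a\in\mathbb{R}^m$ with $[A]_{\bar t}\subset a+\mathbb{R}^m_+$. $f$ is proper at the sublevel $\bar t\in\mathbb{R}^m$ if for each compact subset $A\subset[\mathbb{R}^m]_{\bar t}=\bar t-\mathbb{R}^m_+$ the inverse image $f^{-1}(A)$ is compact. The Rabier function is $\nu_f(x):=\min_{\sum_{i=1}^m|\lambda_i|=1}\big\|\sum_{i=1}^m\lambda_i\nabla f_i(x)\big\|$. The tangency variety is $$\Gamma(f)=\Big\{x\in\mathbb{R}^n\ \Big|\ \exists\,\lambda_1,\ldots,\lambda_m,\mu\in\mathbb{R}\text{ not all zero with }\sum_{i=1}^m\lambda_i\nabla f_i(x)+\mu x=0\Big\}.$$ Define: $\widetilde K_{\infty,\le\bar t}(f)$ = set of $t\in\mathbb{R}^m$ for which there is a sequence $\{x^k\}\subset\mathbb{R}^n$ with $f(x^k)\le\bar t$ for all $k$, $\|x^k\|\to+\infty$, $f(x^k)\to t$ and $\nu_f(x^k)\to0$ as $k\to\infty$; $K_{\infty,\le\bar t}(f)$ = set of $t\in\mathbb{R}^m$ for which there is a sequence $\{x^k\}\subset\mathbb{R}^n$ with $f(x^k)\le\bar t$ for all $k$,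 $\|x^k\|\to+\infty$, $f(x^k)\to t$ and $\|x^k\|\nu_f(x^k)\to0$ as $k\to\infty$; $T_{\infty,\le\bar t}(f)$ = set of $t\in\mathbb{R}^m$ for which there is a sequence $\{x^k\}\subset\Gamma(f)$ with $f(x^k)\le\bar t$ for all $k$, $\|x^k\|\to+\infty$ and $f(x^k)\to t$ as $k\to\infty$. *)

theory Defs
  imports "HOL-Analysis.Analysis"
begin

definition nonneg_orthant :: "(real^'m) set"
  where "nonneg_orthant = {s. 0 \<le> s}"

text \<open>The library order on \<open>real^'m\<close> is the componentwise one.\<close>

lemma le_iff_diff_in_nonneg_orthant:
  fixes s t :: "real^'m"
  shows "s \<le> t \<longleftrightarrow> t - s \<in> nonneg_orthant"
  by (simp add: nonneg_orthant_def less_eq_vec_def)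

definition sect :: "(real^'m) set \<Rightarrow> real^'m \<Rightarrow> (real^'m) set"
  where "sect A t = A \<inter> {t - s | s. s \<in> nonneg_orthant}"

text \<open>Only lower bounds matter: a section is bounded above by its base point \<open>t\<close> by construction.\<close>

definition bounded_sect :: "(real^'m) set \<Rightarrow> real^'m \<Rightarrow> bool"
  where "bounded_sect A t \<longleftrightarrow> (\<exists>a. sect A t \<subseteq> {a + s | s. s \<in> nonneg_orthant})"

definition proper_at_sublevel :: "(real^'n \<Rightarrow> real^'m) \<Rightarrow> real^'m \<Rightarrow> bool"
  where "proper_at_sublevel f t \<longleftrightarrow>
    (\<forall>A. compact A \<and> A \<subseteq> sect UNIV t \<longrightarrow> compact (f -` A))"

definition grad :: "(real^'n \<Rightarrow> real) \<Rightarrow> real^'n \<Rightarrow> real^'n"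
  where "grad g x = (THE D. GDERIV g x :> D)"

definition grad_comb :: "(real^'n \<Rightarrow> real^'m) \<Rightarrow> real^'m \<Rightarrow> real^'n \<Rightarrow> real^'n"
  where "grad_comb f l x = (\<Sum>i\<in>UNIV. l $ i *\<^sub>R grad (\<lambda>y. f y $ i) x)"

text \<open>The infimum below is a minimum; see \<open>rabier_attained\<close>.\<close>

definition rabier :: "(real^'n \<Rightarrow> real^'m) \<Rightarrow> real^'n \<Rightarrow> real"
  where "rabier f x = (INF l \<in> {l. (\<Sum>i\<in>UNIV. \<bar>l $ i\<bar>) = 1}. norm (grad_comb f l x))"

lemma rabier_attained:
  fixes f :: "real^'n \<Rightarrow> real^'m"
  shows "\<exists>l. (\<Sum>i\<in>UNIV. \<bar>l $ i\<bar>) = 1 \<and> rabier f x = norm (grad_comb f l x)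
    \<and> (\<forall>l'. (\<Sum>i\<in>UNIV. \<bar>l' $ i\<bar>) = 1 \<longrightarrow> norm (grad_comb f l x) \<le> norm (grad_comb f l' x))"
proof -
  define S where "S = {l :: real^'m. (\<Sum>i\<in>UNIV. \<bar>l $ i\<bar>) = 1}"
  have "closed S"
    unfolding S_def by (intro closed_Collect_eq continuous_intros)
  moreover have "bounded S"
    unfolding bounded_iff S_def by (intro exI[of _ 1]) (auto intro: norm_le_l1_cart[THEN order_trans])
  ultimately have "compact S"
    by (simp add: compact_eq_bounded_closed)
  moreover have "axis undefined 1 \<in> S"
    by (simp add: S_def axis_def if_distrib cong: if_cong)
  moreover have "continuous_on S (\<lambda>l. norm (grad_comb f l x))"
    unfolding grad_comb_def by (intro continuous_intros)
  ultimately obtain l where l: "l \<in> S" "\<forall>l'\<in>S. norm (grad_comb f l x) \<le> norm (grad_comb f l' x)"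
    using continuous_attains_inf[of S "\<lambda>l. norm (grad_comb f l x)"] by blast
  have "rabier f x = norm (grad_comb f l x)"
    unfolding rabier_def S_def[symmetric] by (rule cInf_eq_minimum) (use l in auto)
  with l show ?thesis
    by (auto simp: S_def)
qed

definition tangency_variety :: "(real^'n \<Rightarrow> real^'m) \<Rightarrow> (real^'n) set"
  where "tangency_variety f = {x. \<exists>l \<mu>. (l \<noteq> 0 \<or> \<mu> \<noteq> 0) \<and> grad_comb f l x + \<mu> *\<^sub>R x = 0}"

definition K_tilde_inf :: "(real^'n \<Rightarrow> real^'m) \<Rightarrow> real^'m \<Rightarrow> (real^'m) set"
  where "K_tilde_inf f tbar = {t. \<exists>x :: nat \<Rightarrow> real^'n.
    (\<forall>k. f (x k) \<le> tbar) \<and>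
    filterlim (\<lambda>k. norm (x k)) at_top sequentially \<and>
    (\<lambda>k. f (x k)) \<longlonglongrightarrow> t \<and>
    (\<lambda>k. rabier f (x k)) \<longlonglongrightarrow> 0}"

definition K_inf :: "(real^'n \<Rightarrow> real^'m) \<Rightarrow> real^'m \<Rightarrow> (real^'m) set"
  where "K_inf f tbar = {t. \<exists>x :: nat \<Rightarrow> real^'n.
    (\<forall>k. f (x k) \<le> tbar) \<and>
    filterlim (\<lambda>k. norm (x k)) at_top sequentially \<and>
    (\<lambda>k. f (x k)) \<longlonglongrightarrow> t \<and>
    (\<lambda>k. norm (x k) * rabier f (x k)) \<longlonglongrightarrow> 0}"

definition T_inf :: "(real^'n \<Rightarrow> real^'m) \<Rightarrow> real^'m \<Rightarrow> (real^'m) set"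
  where "T_inf f tbar = {t. \<exists>x :: nat \<Rightarrow> real^'n.
    (\<forall>k. x k \<in> tangency_variety f) \<and>
    (\<forall>k. f (x k) \<le> tbar) \<and>
    filterlim (\<lambda>k. norm (x k)) at_top sequentially \<and>
    (\<lambda>k. f (x k)) \<longlonglongrightarrow> t}"

definition palais_smale_at :: "(real^'n \<Rightarrow> real^'m) \<Rightarrow> real^'m \<Rightarrow> bool"
  where "palais_smale_at f tbar \<longleftrightarrow> K_tilde_inf f tbar = {}"

definition weak_palais_smale_at :: "(real^'n \<Rightarrow> real^'m) \<Rightarrow> real^'m \<Rightarrow> bool"
  where "weak_palais_smale_at f tbar \<longleftrightarrow> K_inf f tbar = {}"

definition M_tame_at :: "(real^'n \<Rightarrow> real^'m) \<Rightarrow> real^'m \<Rightarrow> bool"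
  where "M_tame_at f tbar \<longleftrightarrow> T_inf f tbar = {}"

end

theory Submission
  imports Defs
begin

text \<open>
  Since the section is bounded below, properness at \<open>t\<close> means that the sublevel \<open>{x. f x \<le> t}\<close> is
  bounded, and along any sequence in it the values of \<open>f\<close> subconverge. If it is unbounded,
  minimising one component of \<open>f\<close> over its intersection with large spheres gives points of the
  tangency variety escaping to infinity. Minimising instead a component plus the penalty
  \<open>\<delta> (ln |y| - ln |x|)\<^sup>2\<close>, where \<open>x\<close> is a far point of the sublevel, gives an interior minimum \<open>y\<close> on
  a wide logarithmic annulus around \<open>x\<close>; there the gradients of \<open>f\<close> are dependent up to the gradient
  of the penalty, whose norm is small compared with \<open>1 / |y|\<close>. In both cases linear independence of
  the gradients would yield a direction in which all components decrease at once, so neither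
  multiplier signs nor the curve selection lemma are needed.
\<close>

section \<open>Gradients and derivatives along curves\<close>

text \<open>\<open>grad\<close> is a definite description, so it has to be shown to denote:
  \<open>adjoint g' 1\<close> represents the derivative \<open>g'\<close> as an inner product, and
  uniqueness of derivatives leaves no other such vector.\<close>

lemma GDERIV_grad:
  fixes g :: "real^'n \<Rightarrow> real"
  assumes "g differentiable at x"
  shows "GDERIV g x :> grad g x"
proof -
  from assms obtain g' where g': "(g has_derivative g') (at x)"
    by (auto simp: differentiable_def)
  then have "linear g'"
    by (rule has_derivative_linear)
  then have "g' = (\<lambda>h. h \<bullet> adjoint g' 1)"
    by (simp add: adjoint_works)
  with g' have D: "GDERIV g x :> adjoint g' 1"
    by (simp add: gderiv_def)
  have unique: "E = E'" if "GDERIV g x :> E" "GDERIV g x :> E'" for E E'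
  proof -
    have "(\<lambda>h. h \<bullet> E) = (\<lambda>h. h \<bullet> E')"
      using that has_derivative_unique unfolding gderiv_def by blast
    then show ?thesis
      using vector_eq_ldot[of E E'] by (simp add: fun_eq_iff)
  qed
  show ?thesis
    unfolding grad_def by (rule theI[of _ "adjoint g' 1"]) (use D unique in blast)+
qed

lemma DERIV_along_curve:
  fixes g :: "real^'n \<Rightarrow> real"
  assumes "g differentiable at (c s)" and "(c has_vector_derivative v) (at s)"
  shows "((\<lambda>s. g (c s)) has_real_derivative grad g (c s) \<bullet> v) (at s)"
proof -
  have "((\<lambda>s. g (c s)) has_derivative (\<lambda>h. (h *\<^sub>R v) \<bullet> grad g (c s))) (at s)"
    using has_derivative_compose[of c "\<lambda>h. h *\<^sub>R v" s UNIV g] assms GDERIV_grad[of g "c s"]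
    unfolding gderiv_def has_vector_derivative_def by blast
  moreover have "(\<lambda>h. (h *\<^sub>R v) \<bullet> grad g (c s)) = (*) (grad g (c s) \<bullet> v)"
    by (auto simp: inner_commute mult.commute)
  ultimately show ?thesis
    by (simp add: has_field_derivative_def)
qed

section \<open>Simultaneous descent directions\<close>

text \<open>Independence makes the linear map \<open>T\<close> onto, so it attains the vector with
  all entries -1. A nonzero \<open>l\<close> orthogonal to its range would give
  \<open>w \<bullet> w = l \<bullet> T w = 0\<close> for the combination \<open>w\<close> of the
  \<open>g i\<close>, that is, a nontrivial relation.\<close>

lemma ex_descent_direction:
  fixes g :: "'m::finite \<Rightarrow> 'a::euclidean_space"
  assumes "\<And>l :: real^'m. (\<Sum>i\<in>UNIV. l $ i *\<^sub>R g i) = 0 \<Longrightarrow> l = 0"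
  shows "\<exists>v. \<forall>i. g i \<bullet> v = - 1"
proof -
  define T where "T v = (\<chi> i. g i \<bullet> v)" for v
  have lin: "linear T"
    by (rule linearI) (auto simp: T_def vec_eq_iff inner_right_distrib)
  have "range T = UNIV"
  proof (rule ccontr)
    assume "range T \<noteq> UNIV"
    moreover have "span (range T) = range T"
      using lin by (simp add: linear_subspace_image span_eq_iff)
    ultimately have "span (range T) \<subset> span UNIV"
      by (metis psubsetI span_UNIV subset_UNIV)
    then obtain l where l: "l \<noteq> 0" "\<And>y. y \<in> span (range T) \<Longrightarrow> orthogonal l y"
      using orthogonal_to_subspace_exists_gen[of "range T" UNIV] by metis
    define w where "w = (\<Sum>i\<in>UNIV. l $ i *\<^sub>R g i)"
    have "w \<bullet> w = l \<bullet> T w"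
      by (subst (1) w_def) (simp add: T_def inner_vec_def inner_sum_left)
    also have "\<dots> = 0"
      using l(2)[of "T w"] by (simp add: orthogonal_def span_base)
    finally show False
      using assms[of l] l(1) by (simp add: w_def)
  qed
  then obtain v where "T v = (\<chi> i. - 1)"
    by (metis UNIV_I imageE)
  then show ?thesis
    by (auto simp: T_def vec_eq_iff)
qed

lemma eventually_all_less_if_DERIV_neg:
  fixes \<phi> :: "'m::finite \<Rightarrow> real \<Rightarrow> real"
  assumes "\<And>i. (\<phi> i has_real_derivative D i) (at s)" and "\<And>i. D i < 0"
  shows "\<forall>\<^sub>F t in at_right s. \<forall>i. \<phi> i t < \<phi> i s"
proof (rule eventually_all_finite)
  fix i
  obtain d where d: "d > 0" "\<forall>h>0. h < d \<longrightarrow> \<phi> i s > \<phi> i (s + h)"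
    using DERIV_neg_dec_right[OF assms] by blast
  then have "\<phi> i t < \<phi> i s" if "s < t" "t < s + d" for t
    using that d(2)[rule_format, of "t - s"] by simp
  with \<open>d > 0\<close> show "\<forall>\<^sub>F t in at_right s. \<phi> i t < \<phi> i s"
    by (auto simp: eventually_at_right[of s "s + d"] intro!: exI[of _ "s + d"])
qed

section \<open>Bounds for the Rabier function\<close>

lemma rabier_nonneg: "0 \<le> rabier f x"
  by (metis norm_ge_zero rabier_attained)

text \<open>Both sides scale alike with positive factors of \<open>l\<close>, so \<open>l\<close>
  may be normalised. This turns a multiplier relation into an upper bound for
  \<open>rabier\<close>.\<close>

lemma rabier_le:
  assumes "l \<noteq> 0"
  shows "(\<Sum>i\<in>UNIV. \<bar>l $ i\<bar>) * rabier f x \<le> norm (grad_comb f l x)"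
proof -
  define S where "S = (\<Sum>i\<in>UNIV. \<bar>l $ i\<bar>)"
  have "S \<noteq> 0"
    using assms by (auto simp: S_def sum_nonneg_eq_0_iff vec_eq_iff)
  moreover have "S \<ge> 0"
    by (auto simp: S_def intro: sum_nonneg)
  ultimately have "S > 0"
    by simp
  then have "(\<Sum>i\<in>UNIV. \<bar>((1/S) *\<^sub>R l) $ i\<bar>) = 1"
    by (simp add: abs_mult sum_divide_distrib[symmetric] flip: S_def)
  then have "rabier f x \<le> norm (grad_comb f ((1/S) *\<^sub>R l) x)"
    by (metis rabier_attained)
  also have "grad_comb f ((1/S) *\<^sub>R l) x = (1/S) *\<^sub>R grad_comb f l x"
    by (simp add: grad_comb_def scaleR_sum_right)
  finally show ?thesis
    using \<open>S > 0\<close> by (simp add: S_def[symmetric] field_simps)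
qed

section \<open>The logarithmic penalty and minima on annuli\<close>

lemma DERIV_ln_norm_along_line:
  fixes y v :: "'a::real_inner"
  assumes "y \<noteq> 0"
  shows "((\<lambda>s. ln (norm (y + s *\<^sub>R v))) has_real_derivative (y \<bullet> v) / (norm y)\<^sup>2) (at 0)"
proof -
  have "((\<lambda>s. y + s *\<^sub>R v) has_derivative (\<lambda>h. h *\<^sub>R v)) (at 0)"
    by (auto intro!: derivative_eq_intros)
  then have "((\<lambda>s. norm (y + s *\<^sub>R v)) has_derivative (\<lambda>h. (h *\<^sub>R v) \<bullet> sgn y)) (at 0)"
    using has_derivative_compose[of "\<lambda>s. y + s *\<^sub>R v" "\<lambda>h. h *\<^sub>R v" 0 UNIV norm "\<lambda>h. h \<bullet> sgn y"]
      has_derivative_norm[OF assms]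
    by simp
  moreover have "(\<lambda>h. (h *\<^sub>R v) \<bullet> sgn y) = (*) ((y \<bullet> v) / norm y)"
    by (auto simp: sgn_div_norm inner_commute field_simps)
  ultimately have "((\<lambda>s. norm (y + s *\<^sub>R v)) has_real_derivative (y \<bullet> v) / norm y) (at 0)"
    by (simp add: has_field_derivative_def)
  then show ?thesis
    by (rule DERIV_chain'[THEN DERIV_cong, OF _ DERIV_ln_divide])
      (use assms in \<open>auto simp: power2_eq_square\<close>)
qed

text \<open>The vector paired with \<open>v\<close> is the gradient of the penalty. Its norm is
  \<open>2 * \<bar>\<delta>\<bar> * \<bar>ln (norm y) - c\<bar> / norm y\<close>; the factor
  \<open>1 / norm y\<close> is the reason for the logarithm.\<close>

lemma DERIV_along_line_sq_ln_norm:
  fixes y v :: "'a::real_inner"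
  assumes "y \<noteq> 0"
  shows "((\<lambda>s. \<delta> * (ln (norm (y + s *\<^sub>R v)) - c)\<^sup>2) has_real_derivative
    ((2 * \<delta> * (ln (norm y) - c) / (norm y)\<^sup>2) *\<^sub>R y) \<bullet> v) (at 0)"
  by (rule DERIV_cong, (rule derivative_intros DERIV_ln_norm_along_line assms)+) simp

text \<open>\<open>D\<close> is the half-width of the annulus on the logarithmic scale, and
  \<open>C\<close> exceeds the range of component \<open>j\<close> on the sublevel. At the minimum a
  combination of the gradients of \<open>f\<close> balances a multiple of the penalty gradient, and
  \<open>norm y\<close> times the norm of the latter is at most \<open>2 * C / D\<close>.\<close>

lemma ex_small_norm_times_rabier:
  fixes f :: "real^'n \<Rightarrow> real^'m"
  assumes diff: "\<And>x i. (\<lambda>y. f y $ i) differentiable at x"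
    and lower: "\<And>x. f x \<le> t \<Longrightarrow> a \<le> f x"
    and x: "f x \<le> t" "x \<noteq> 0"
    and D: "D > 0" and C: "C > 0" "t $ j < a $ j + C"
  shows "\<exists>y. f y \<le> t \<and> norm x * exp (- D) \<le> norm y \<and> norm y * rabier f y \<le> 2 * C / D"
proof -
  \<comment> \<open>This weight makes the penalty equal to \<open>C\<close> on the boundary of the annulus, so that the minimum
    cannot lie there.\<close>
  define \<delta> where "\<delta> = C / D\<^sup>2"
  define p where "p y = \<delta> * (ln (norm y) - ln (norm x))\<^sup>2" for y :: "real^'n"
  define h where "h y = f y $ j + p y" for y
  define A where "A = {y. norm x * exp (- D) \<le> norm y \<and> norm y \<le> norm x * exp D \<and> f y \<le> t}"
  have \<delta>: "\<delta> > 0"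
    using C D by (simp add: \<delta>_def)
  have cont: "continuous_on UNIV (\<lambda>y. f y $ i)" for i
    by (intro differentiable_imp_continuous_on) (simp add: differentiable_on_def diff)
  have "A = {y. norm x * exp (- D) \<le> norm y} \<inter> {y. norm y \<le> norm x * exp D} \<inter> (\<Inter>i. {y. f y $ i \<le> t $ i})"
    by (auto simp: A_def less_eq_vec_def)
  then have "closed A"
    by (auto intro!: closed_Int closed_INT closed_Collect_le cont continuous_intros)
  moreover have "bounded A"
    by (auto simp: A_def bounded_iff)
  ultimately have "compact A"
    by (simp add: compact_eq_bounded_closed)
  moreover have nz: "norm y > 0" if "y \<in> A" for y
  proof -
    have "0 < norm x * exp (- D)"
      using x(2) by simp
    also have "\<dots> \<le> norm y"
      using that by (simp add: A_def)
    finally show ?thesis .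
  qed
  then have "continuous_on A h"
    unfolding h_def p_def
    by (intro continuous_intros continuous_on_subset[OF cont]) force+
  moreover have xA: "x \<in> A"
    using x D by (auto simp: A_def)
  ultimately obtain y where y: "y \<in> A" "\<And>z. z \<in> A \<Longrightarrow> h y \<le> h z"
    using continuous_attains_inf[of A h] by blast
  have y0: "norm y > 0" "y \<noteq> 0"
    using nz[OF y(1)] by auto
  have fy: "f y \<le> t"
    using y by (simp add: A_def)
  have hx: "h x \<le> t $ j"
    using x by (simp add: h_def p_def less_eq_vec_def)
  have hy: "h y \<le> t $ j"
    using y(2)[OF xA] hx by simp
  define L where "L = ln (norm y) - ln (norm x)"
  \<comment> \<open>\<open>f y $ j + p y\<close> is at most \<open>t $ j\<close>, while
    \<open>f y $ j\<close> is at least \<open>a $ j > t $ j - C\<close>.\<close>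
  have "p y < C"
    using hy C(2) lower[OF fy] by (simp add: h_def less_eq_vec_def) (smt (verit))
  then have "L\<^sup>2 < D\<^sup>2"
    using C D unfolding p_def \<delta>_def L_def by (simp add: field_simps)
  then have L: "\<bar>L\<bar> < D"
    using D by (metis abs_of_pos power2_less_imp_less power2_abs less_imp_le)
  have "ln (norm x * exp (- D)) < ln (norm y)" "ln (norm y) < ln (norm x * exp D)"
    using L x(2) by (auto simp: L_def ln_mult)
  then have ring: "norm x * exp (- D) < norm y" "norm y < norm x * exp D"
    using x(2) y0 by (auto simp: ln_less_cancel_iff)
  define q where "q = (2 * \<delta> * (ln (norm y) - ln (norm x)) / (norm y)\<^sup>2) *\<^sub>R y"
  \<comment> \<open>These are the gradients of the functions that are to decrease together:
    \<open>h\<close> for index \<open>j\<close>, the plain component of \<open>f\<close>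
    otherwise.\<close>
  define G where "G i = grad (\<lambda>y. f y $ i) y + (if i = j then q else 0)" for i
  have "\<exists>l :: real^'m. l \<noteq> 0 \<and> (\<Sum>i\<in>UNIV. l $ i *\<^sub>R G i) = 0"
  proof (rule ccontr)
    assume "\<not> ?thesis"
    then obtain v where v: "\<And>i. G i \<bullet> v = - 1"
      using ex_descent_direction[of G] by blast
    define \<phi> where "\<phi> i s = f (y + s *\<^sub>R v) $ i + (if i = j then p (y + s *\<^sub>R v) else 0)" for i s
    have line: "((\<lambda>s. y + s *\<^sub>R v) has_vector_derivative v) (at 0)"
      by (auto intro!: derivative_eq_intros)
    have df: "((\<lambda>s. f (y + s *\<^sub>R v) $ i) has_real_derivative grad (\<lambda>y. f y $ i) y \<bullet> v) (at 0)" for i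
      using DERIV_along_curve[OF _ line, of "\<lambda>y. f y $ i"] diff by simp
    have dp: "((\<lambda>s. p (y + s *\<^sub>R v)) has_real_derivative q \<bullet> v) (at 0)"
      unfolding p_def q_def by (rule DERIV_along_line_sq_ln_norm) (rule y0)
    have "(\<phi> i has_real_derivative - 1) (at 0)" for i
      unfolding \<phi>_def v[of i, symmetric]
      by (cases "i = j") (auto simp: G_def inner_add_left intro!: DERIV_add df dp)
    then have "\<forall>\<^sub>F s in at_right 0. \<forall>i. \<phi> i s < \<phi> i 0"
      by (rule eventually_all_less_if_DERIV_neg) simp
    moreover have "((\<lambda>s. norm (y + s *\<^sub>R v)) \<longlongrightarrow> norm y) (at_right 0)"
      by (auto intro!: tendsto_eq_intros)
    from order_tendstoD[OF this] ring
    have "\<forall>\<^sub>F s in at_right 0. norm x * exp (- D) < norm (y + s *\<^sub>R v)"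
      "\<forall>\<^sub>F s in at_right 0. norm (y + s *\<^sub>R v) < norm x * exp D"
      by auto
    ultimately have "\<forall>\<^sub>F s in at_right (0::real). False"
    proof eventually_elim
      case (elim s)
      define z where "z = y + s *\<^sub>R v"
      have hz: "h z < h y"
        using elim(1)[rule_format, of j] by (simp add: \<phi>_def h_def z_def)
      \<comment> \<open>For index \<open>j\<close> only \<open>h\<close> is known to decrease; as
        the penalty is nonnegative, \<open>f z $ j \<le> h z < h y \<le> t $ j\<close> still keeps
        \<open>z\<close> in the sublevel.\<close>
      have "f z $ i \<le> t $ i" for i
      proof (cases "i = j")
        case True
        have "p z \<ge> 0"
          using \<delta> by (simp add: p_def)
        then show ?thesis
          using hz hy True by (simp add: h_def)
      next
        case False
        then have "f z $ i < f y $ i"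
          using elim(1)[rule_format, of i] by (simp add: \<phi>_def z_def)
        also have "\<dots> \<le> t $ i"
          using fy by (simp add: less_eq_vec_def)
        finally show ?thesis by simp
      qed
      then have "z \<in> A"
        using elim by (simp add: A_def z_def less_eq_vec_def)
      with y(2)[of z] hz show False
        by simp
    qed
    then show False
      by simp
  qed
  then obtain l :: "real^'m" where l: "l \<noteq> 0" "(\<Sum>i\<in>UNIV. l $ i *\<^sub>R G i) = 0"
    by blast
  define S where "S = (\<Sum>i\<in>UNIV. \<bar>l $ i\<bar>)"
  have lS: "\<bar>l $ j\<bar> \<le> S"
    unfolding S_def by (rule member_le_sum) auto
  have "S \<noteq> 0"
    using l by (auto simp: S_def sum_nonneg_eq_0_iff vec_eq_iff)
  with lS have S: "S > 0"
    by simp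
  have "(\<Sum>i\<in>UNIV. l $ i *\<^sub>R (if i = j then q else 0)) = l $ j *\<^sub>R q"
    by (simp add: if_distrib cong: if_cong)
  then have "(\<Sum>i\<in>UNIV. l $ i *\<^sub>R G i) = grad_comb f l y + l $ j *\<^sub>R q"
    by (simp add: G_def grad_comb_def scaleR_add_right sum.distrib)
  with l have "grad_comb f l y = - (l $ j *\<^sub>R q)"
    by (simp add: eq_neg_iff_add_eq_0)
  then have "S * rabier f y \<le> \<bar>l $ j\<bar> * norm q"
    using rabier_le[OF l(1), of f y] by (simp add: S_def)
  also have "\<dots> \<le> S * norm q"
    using lS by (simp add: mult_right_mono)
  finally have "rabier f y \<le> norm q"
    using S by simp
  then have "norm y * rabier f y \<le> norm y * norm q"
    using y0 by (simp add: mult_left_mono)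
  \<comment> \<open>The factor \<open>norm y\<close> cancels the \<open>1 / norm y\<close> in the
    size of the gradient of the logarithm.\<close>
  also have "\<dots> = 2 * \<delta> * \<bar>L\<bar>"
    using y0 \<delta> by (simp add: q_def L_def abs_mult power2_eq_square)
  also have "\<dots> \<le> 2 * \<delta> * D"
    using L \<delta> by simp
  also have "\<dots> = 2 * C / D"
    using D by (simp add: \<delta>_def power2_eq_square)
  finally show ?thesis
    using fy ring by (intro exI[of _ y]) auto
qed

section \<open>Tangency points on spheres\<close>

text \<open>Take a minimum of one component over the sphere within the sublevel. Were the tangential
  projections of the gradients independent there, some motion along the sphere would decrease all
  components, contradicting minimality. A relation among the projections is a tangency relation
  whose \<open>\<mu>\<close> collects the radial parts.\<close>

lemma ex_tangency_point_on_sphere: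
  fixes f :: "real^'n \<Rightarrow> real^'m"
  assumes diff: "\<And>x i. (\<lambda>y. f y $ i) differentiable at x"
    and x: "f x \<le> t"
  shows "\<exists>y \<in> tangency_variety f. f y \<le> t \<and> norm y = norm x"
proof (cases "x = 0")
  case True
  \<comment> \<open>At the origin \<open>l = 0\<close> and \<open>\<mu> = 1\<close> are admissible
    multipliers.\<close>
  then have "x \<in> tangency_variety f"
    unfolding tangency_variety_def by (auto intro!: exI[of _ 0] exI[of _ "1::real"] simp: grad_comb_def)
  with x show ?thesis
    by blast
next
  case False
  define A where "A = {y. norm y = norm x \<and> f y \<le> t}"
  define j :: 'm where "j = undefined"
  have cont: "continuous_on UNIV (\<lambda>y. f y $ i)" for i
    by (intro differentiable_imp_continuous_on) (simp add: differentiable_on_def diff)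
  have "A = {y. norm y = norm x} \<inter> (\<Inter>i. {y. f y $ i \<le> t $ i})"
    by (auto simp: A_def less_eq_vec_def)
  then have "closed A"
    by (auto intro!: closed_Int closed_INT closed_Collect_le closed_Collect_eq cont continuous_intros)
  moreover have "bounded A"
    by (auto simp: A_def bounded_iff)
  ultimately have "compact A"
    by (simp add: compact_eq_bounded_closed)
  moreover have "x \<in> A"
    using x by (simp add: A_def)
  ultimately obtain y where y: "y \<in> A" "\<And>z. z \<in> A \<Longrightarrow> f y $ j \<le> f z $ j"
    using continuous_attains_inf[of A "\<lambda>y. f y $ j"] continuous_on_subset[OF cont] by blast
  have y0: "y \<noteq> 0"
    using y False by (auto simp: A_def)
  \<comment> \<open>The orthogonal projection onto the hyperplane tangent to the sphere at
    \<open>y\<close>.\<close>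
  define P where "P v = v - ((v \<bullet> y) / (y \<bullet> y)) *\<^sub>R y" for v
  have Py: "P v \<bullet> y = 0" for v
    using y0 by (simp add: P_def inner_diff_left)
  define G where "G i = P (grad (\<lambda>y. f y $ i) y)" for i
  have "\<exists>l :: real^'m. l \<noteq> 0 \<and> (\<Sum>i\<in>UNIV. l $ i *\<^sub>R G i) = 0"
  proof (rule ccontr)
    assume "\<not> ?thesis"
    then obtain v where v: "\<And>i. G i \<bullet> v = - 1"
      using ex_descent_direction[of G] by blast
    define w where "w = P v"
    have wy: "w \<bullet> y = 0"
      by (simp add: w_def Py)
    \<comment> \<open>\<open>P\<close> is self-adjoint, so it can be moved from the gradient to
      \<open>v\<close>.\<close>
    have gw: "grad (\<lambda>y. f y $ i) y \<bullet> w = - 1" for i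
      using v[of i] by (simp add: G_def w_def P_def inner_diff_left inner_diff_right inner_commute mult.commute)
    then have w0: "w \<noteq> 0"
      by force
    \<comment> \<open>This factor makes \<open>r *\<^sub>R w\<close> as long as \<open>y\<close>;
      the two being orthogonal, \<open>cos s\<close> and \<open>sin s\<close> combine them without
      changing the norm.\<close>
    define r where "r = norm y / norm w"
    have r: "r > 0"
      using y0 w0 by (simp add: r_def)
    \<comment> \<open>A great circle through \<open>y\<close> on the sphere of radius \<open>|x|\<close>, with velocity \<open>r *\<^sub>R w\<close> at \<open>y\<close>.\<close>
    define c where "c s = cos s *\<^sub>R y + (r * sin s) *\<^sub>R w" for s
    have "(norm (c s))\<^sup>2 = (norm y)\<^sup>2" for s
    proof -
      have "(norm (c s))\<^sup>2 = (cos s)\<^sup>2 * (norm y)\<^sup>2 + (r * sin s)\<^sup>2 * (norm w)\<^sup>2"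
        using wy by (simp add: c_def power2_norm_eq_inner inner_add_left inner_add_right inner_commute)
          (simp add: power2_eq_square algebra_simps)
      also have "(r * sin s)\<^sup>2 * (norm w)\<^sup>2 = (sin s)\<^sup>2 * (norm y)\<^sup>2"
        using w0 by (simp add: r_def power_mult_distrib power_divide)
      finally show ?thesis
        by (simp flip: distrib_right)
    qed
    then have norm_c: "norm (c s) = norm x" for s
      using y by (simp add: A_def)
    have c0: "c 0 = y"
      by (simp add: c_def)
    have "(c has_vector_derivative r *\<^sub>R w) (at 0)"
      unfolding c_def[abs_def] by (auto intro!: derivative_eq_intros)
    then have "((\<lambda>s. f (c s) $ i) has_real_derivative - r) (at 0)" for i
      using DERIV_along_curve[of "\<lambda>y. f y $ i" c 0 "r *\<^sub>R w"] diff by (simp add: c0 gw)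
    then have "\<forall>\<^sub>F s in at_right 0. \<forall>i. f (c s) $ i < f (c 0) $ i"
      by (rule eventually_all_less_if_DERIV_neg) (simp add: r)
    then have "\<exists>s. \<forall>i. f (c s) $ i < f (c 0) $ i"
      by (rule eventually_happens'[rotated]) simp
    then obtain s where s: "\<And>i. f (c s) $ i < f y $ i"
      unfolding c0 by blast
    have "f (c s) \<le> f y"
      using s by (simp add: less_eq_vec_def less_imp_le)
    also have "\<dots> \<le> t"
      using y(1) by (simp add: A_def)
    finally have "c s \<in> A"
      using norm_c by (simp add: A_def)
    from y(2)[OF this] s[of j] show False
      by simp
  qed
  then obtain l :: "real^'m" where l: "l \<noteq> 0" "(\<Sum>i\<in>UNIV. l $ i *\<^sub>R G i) = 0"
    by blast
  have "(\<Sum>i\<in>UNIV. l $ i *\<^sub>R G i)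
    = grad_comb f l y + (- (\<Sum>i\<in>UNIV. l $ i * ((grad (\<lambda>y. f y $ i) y \<bullet> y) / (y \<bullet> y)))) *\<^sub>R y"
    by (simp add: G_def P_def grad_comb_def scaleR_diff_right sum_subtractf scaleR_sum_left)
  with l have "y \<in> tangency_variety f"
    unfolding tangency_variety_def by (metis (mono_tags, lifting) mem_Collect_eq)
  with y show ?thesis
    by (auto simp: A_def)
qed

section \<open>Sections, properness and bounded sublevels\<close>

lemma vimage_box_eq_sublevel:
  fixes f :: "real^'n \<Rightarrow> real^'m"
  assumes "\<And>x. f x \<le> t \<Longrightarrow> a \<le> f x"
  shows "f -` {a..t} = {x. f x \<le> t}"
  using assms by auto

lemma mem_sect_iff: "y \<in> sect A t \<longleftrightarrow> y \<in> A \<and> y \<le> t"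
proof -
  have "y \<in> {t - s | s. s \<in> nonneg_orthant} \<longleftrightarrow> y \<le> t"
    unfolding le_iff_diff_in_nonneg_orthant by (auto intro!: exI[of _ "t - y"])
  then show ?thesis
    by (simp add: sect_def)
qed

lemma bounded_sect_range_iff:
  fixes f :: "real^'n \<Rightarrow> real^'m"
  shows "bounded_sect (range f) t \<longleftrightarrow> (\<exists>a. \<forall>x. f x \<le> t \<longrightarrow> a \<le> f x)"
proof -
  have "y \<in> {a + s | s. s \<in> nonneg_orthant} \<longleftrightarrow> a \<le> y" for a y :: "real^'m"
    unfolding le_iff_diff_in_nonneg_orthant by (auto intro!: exI[of _ "y - a"])
  then show ?thesis
    unfolding bounded_sect_def subset_iff mem_sect_iff by blast
qed

lemma compact_Icc_cart: "compact {a..b :: real^'m}"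
  by (simp add: interval_cbox_cart compact_cbox)

lemma compact_vimage_box_if_proper:
  assumes "proper_at_sublevel f t"
  shows "compact (f -` {a..t})"
proof -
  have "{a..t} \<subseteq> sect UNIV t"
    by (auto simp: mem_sect_iff)
  with assms compact_Icc_cart[of a t] show ?thesis
    unfolding proper_at_sublevel_def by blast
qed

text \<open>The box \<open>{a..t}\<close> is a compact part of the section of the whole space, and
  its preimage is the entire sublevel. Conversely, preimages of compact sets are closed by
  continuity and lie in the bounded sublevel.\<close>

lemma proper_at_sublevel_iff_bounded:
  fixes f :: "real^'n \<Rightarrow> real^'m"
  assumes cont: "continuous_on UNIV f"
    and lower: "\<And>x. f x \<le> t \<Longrightarrow> a \<le> f x"
  shows "proper_at_sublevel f t \<longleftrightarrow> bounded {x. f x \<le> t}"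
proof
  assume "proper_at_sublevel f t"
  then have "compact (f -` {a..t})"
    by (rule compact_vimage_box_if_proper)
  then show "bounded {x. f x \<le> t}"
    using vimage_box_eq_sublevel[of f, OF lower] compact_imp_bounded by metis
next
  assume bdd: "bounded {x. f x \<le> t}"
  show "proper_at_sublevel f t"
    unfolding proper_at_sublevel_def
  proof (intro allI impI)
    fix A assume A: "compact A \<and> A \<subseteq> sect UNIV t"
    have "closed (f -` A)"
      using A cont by (metis compact_imp_closed continuous_closed_vimage continuous_on_eq_continuous_at open_UNIV UNIV_I)
    moreover have "bounded (f -` A)"
      using A by (intro bounded_subset[OF bdd]) (auto simp: mem_sect_iff subset_iff)
    ultimately show "compact (f -` A)"
      by (simp add: compact_eq_bounded_closed)
  qed
qed

lemma bounded_sublevel_no_escaping_sequence: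
  assumes "bounded {x. f x \<le> t}" and "\<And>k. f (x k) \<le> t"
    and "filterlim (\<lambda>k. norm (x k)) at_top sequentially"
  shows False
proof -
  from assms(1) obtain B where "\<And>k. norm (x k) \<le> B"
    using assms(2) unfolding bounded_iff by blast
  moreover obtain k where "norm (x k) > B"
    using assms(3) unfolding filterlim_at_top_dense eventually_sequentially by blast
  ultimately show False
    by (meson not_le)
qed

section \<open>Asymptotic sets of unbounded sublevels\<close>

text \<open>Once \<open>norm (x k)\<close> is at least 1, the product with
  \<open>rabier f (x k)\<close> dominates \<open>rabier f (x k)\<close> itself.\<close>

lemma K_inf_subset_K_tilde_inf: "K_inf f t \<subseteq> K_tilde_inf f t"
proof
  fix s assume "s \<in> K_inf f t"
  then obtain x where x: "\<forall>k. f (x k) \<le> t" "filterlim (\<lambda>k. norm (x k)) at_top sequentially"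
    "(\<lambda>k. f (x k)) \<longlonglongrightarrow> s" "(\<lambda>k. norm (x k) * rabier f (x k)) \<longlonglongrightarrow> 0"
    unfolding K_inf_def by blast
  have "\<forall>\<^sub>F k in sequentially. 1 \<le> norm (x k)"
    using x(2) unfolding filterlim_at_top by blast
  then have "\<forall>\<^sub>F k in sequentially. norm (rabier f (x k)) \<le> norm (x k) * rabier f (x k)"
    by eventually_elim (use rabier_nonneg[of f] mult_right_mono[of 1] in force)
  then have "(\<lambda>k. rabier f (x k)) \<longlonglongrightarrow> 0"
    using x(4) by (rule Lim_null_comparison)
  with x show "s \<in> K_tilde_inf f t"
    unfolding K_tilde_inf_def by blast
qed

text \<open>The lower bound traps the values in the compact box \<open>{a..t}\<close>, so a sequence
  escaping to infinity in the sublevel always yields a candidate limit value.\<close>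

lemma ex_convergent_subsequence_sublevel:
  fixes f :: "real^'n \<Rightarrow> real^'m"
  assumes "\<And>x. f x \<le> t \<Longrightarrow> a \<le> f x" and "\<And>k. f (y k) \<le> t"
  shows "\<exists>s r. strict_mono (r :: nat \<Rightarrow> nat) \<and> (\<lambda>k. f (y (r k))) \<longlonglongrightarrow> s"
proof -
  have "\<forall>k. f (y k) \<in> {a..t}"
    using assms by auto
  then show ?thesis
    using compact_Icc_cart[of a t] unfolding compact_def by (fastforce simp: o_def)
qed

text \<open>Annuli of growing logarithmic half-width \<open>k + 1\<close>, placed far enough out,
  give points that escape to infinity while the bound \<open>2 * C / (k + 1)\<close> tends to
  0.\<close>

lemma K_inf_nonempty_if_unbounded_sublevel:
  fixes f :: "real^'n \<Rightarrow> real^'m"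
  assumes diff: "\<And>x i. (\<lambda>y. f y $ i) differentiable at x"
    and lower: "\<And>x. f x \<le> t \<Longrightarrow> a \<le> f x"
    and unb: "\<not> bounded {x. f x \<le> t}"
  shows "K_inf f t \<noteq> {}"
proof -
  define j :: 'm where "j = undefined"
  define C where "C = max 0 (t $ j - a $ j) + 1"
  have C: "C > 0" "t $ j < a $ j + C"
    by (auto simp: C_def)
  have "\<exists>y. f y \<le> t \<and> exp (real k + 1) \<le> norm y \<and> norm y * rabier f y \<le> 2 * C / (real k + 1)" for k :: nat
  proof -
    \<comment> \<open>The shift by one keeps \<open>D\<close> positive at
      \<open>k = 0\<close>.\<close>
    define D where "D = real k + 1"
    have D: "D > 0"
      by (simp add: D_def)
    \<comment> \<open>Starting beyond \<open>exp (2 * D)\<close> puts even the inner radius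
      \<open>norm x * exp (- D)\<close> beyond \<open>exp D\<close>.\<close>
    obtain x where x: "f x \<le> t" "norm x > exp (2 * D)"
      using unb unfolding bounded_iff by (metis (mono_tags, lifting) mem_Collect_eq not_le)
    then have "x \<noteq> 0"
      by (metis exp_gt_zero norm_zero not_less_iff_gr_or_eq)
    then obtain y where y: "f y \<le> t" "norm x * exp (- D) \<le> norm y" "norm y * rabier f y \<le> 2 * C / D"
      using ex_small_norm_times_rabier[OF diff lower x(1) _ D C] by blast
    have "exp D = exp (2 * D) * exp (- D)"
      by (simp flip: exp_add)
    also have "\<dots> \<le> norm x * exp (- D)"
      using x by simp
    finally show ?thesis
      using y unfolding D_def by (meson order_trans)
  qed
  then obtain y where y: "\<And>k. f (y k) \<le> t" "\<And>k. exp (real k + 1) \<le> norm (y k)"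
    "\<And>k. norm (y k) * rabier f (y k) \<le> 2 * C / (real k + 1)"
    by metis
  obtain s r where r: "strict_mono (r :: nat \<Rightarrow> nat)" "(\<lambda>k. f (y (r k))) \<longlonglongrightarrow> s"
    using ex_convergent_subsequence_sublevel[of f t a y] lower y(1) by blast
  have "real k \<le> norm (y k)" for k
    using exp_ge_add_one_self[of "real k + 1"] y(2)[of k] by simp
  then have "filterlim (\<lambda>k. norm (y k)) at_top sequentially"
    by (intro filterlim_at_top_mono[OF filterlim_real_sequentially]) auto
  then have "filterlim (\<lambda>k. norm (y (r k))) at_top sequentially"
    using filterlim_compose filterlim_subseq[OF r(1)] by blast
  moreover have "(\<lambda>k. 2 * C / (real k + 1)) \<longlonglongrightarrow> 0"
    using tendsto_mult[OF tendsto_const[of "2 * C"] LIMSEQ_inverse_real_of_nat]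
    by (simp add: divide_inverse add.commute)
  then have "(\<lambda>k. norm (y k) * rabier f (y k)) \<longlonglongrightarrow> 0"
    by (rule Lim_null_comparison[rotated]) (use y(3) rabier_nonneg[of f] in auto)
  then have "(\<lambda>k. norm (y (r k)) * rabier f (y (r k))) \<longlonglongrightarrow> 0"
    using LIMSEQ_subseq_LIMSEQ[OF _ r(1)] by (fastforce simp: o_def)
  ultimately have "s \<in> K_inf f t"
    unfolding K_inf_def using y(1) r(2) by (auto intro!: exI[of _ "\<lambda>k. y (r k)"])
  then show ?thesis
    by blast
qed

text \<open>Each sphere through a far point of the sublevel carries a tangency point in the
  sublevel; such points escape to infinity, and a subsequence has convergent values.\<close>

lemma T_inf_nonempty_if_unbounded_sublevel:
  fixes f :: "real^'n \<Rightarrow> real^'m"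
  assumes diff: "\<And>x i. (\<lambda>y. f y $ i) differentiable at x"
    and lower: "\<And>x. f x \<le> t \<Longrightarrow> a \<le> f x"
    and unb: "\<not> bounded {x. f x \<le> t}"
  shows "T_inf f t \<noteq> {}"
proof -
  have "\<exists>y \<in> tangency_variety f. f y \<le> t \<and> real k \<le> norm y" for k
  proof -
    obtain x where "f x \<le> t" "norm x > real k"
      using unb unfolding bounded_iff by (metis (mono_tags, lifting) mem_Collect_eq not_le)
    then show ?thesis
      using ex_tangency_point_on_sphere[OF diff, of x t] by force
  qed
  then obtain y where y: "\<And>k. y k \<in> tangency_variety f" "\<And>k. f (y k) \<le> t" "\<And>k. real k \<le> norm (y k)"
    by metis
  obtain s r where r: "strict_mono (r :: nat \<Rightarrow> nat)" "(\<lambda>k. f (y (r k))) \<longlonglongrightarrow> s"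
    using ex_convergent_subsequence_sublevel[of f t a y] lower y(2) by blast
  have "filterlim (\<lambda>k. norm (y k)) at_top sequentially"
    using y(3) by (intro filterlim_at_top_mono[OF filterlim_real_sequentially]) auto
  then have "filterlim (\<lambda>k. norm (y (r k))) at_top sequentially"
    using filterlim_compose filterlim_subseq[OF r(1)] by blast
  then have "s \<in> T_inf f t"
    unfolding T_inf_def using y r(2) by (auto intro!: exI[of _ "\<lambda>k. y (r k)"])
  then show ?thesis
    by blast
qed

section \<open>Closedness of the section and the equivalences\<close>

text \<open>The section is the continuous image of the sublevel, which properness makes compact as
  the preimage of \<open>{a..t}\<close>.\<close>

lemma closed_sect_range:
  fixes f :: "real^'n \<Rightarrow> real^'m"
  assumes "continuous_on UNIV f" and "\<And>x. f x \<le> t \<Longrightarrow> a \<le> f x" and "proper_at_sublevel f t"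
  shows "closed (sect (range f) t)"
proof -
  have "compact (f -` {a..t})"
    using assms(3) by (rule compact_vimage_box_if_proper)
  then have "compact (f ` (f -` {a..t}))"
    using assms(1) by (metis compact_continuous_image continuous_on_subset subset_UNIV)
  moreover have "f ` (f -` {a..t}) = sect (range f) t"
    using assms(2) by (auto simp: mem_sect_iff)
  ultimately show ?thesis
    by (simp add: compact_imp_closed)
qed

theorem theorem3p2:
  fixes f :: "real^'n \<Rightarrow> real^'m" and tbar :: "real^'m"
  assumes "polynomial_function f"
    and "tbar \<in> range f"
    and "bounded_sect (range f) tbar"
  shows "(proper_at_sublevel f tbar \<longleftrightarrow> palais_smale_at f tbar) \<and>
    (palais_smale_at f tbar \<longleftrightarrow> weak_palais_smale_at f tbar) \<and>
    (weak_palais_smale_at f tbar \<longleftrightarrow> M_tame_at f tbar) \<and>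
    (proper_at_sublevel f tbar \<or> palais_smale_at f tbar \<or>
      weak_palais_smale_at f tbar \<or> M_tame_at f tbar \<longrightarrow> closed (sect (range f) tbar))"
proof -
  obtain a where lower: "\<And>x. f x \<le> tbar \<Longrightarrow> a \<le> f x"
    using assms(3) unfolding bounded_sect_range_iff by blast
  have cont: "continuous_on UNIV f"
    using assms(1) by (rule continuous_on_polymonial_function)
  have diff: "(\<lambda>y. f y $ i) differentiable at x" for x i
    using differentiable_at_polynomial_function[OF assms(1), of x UNIV]
      bounded_linear.has_derivative[OF bounded_linear_vec_nth, of f _ "at x" i]
    unfolding differentiable_def by blast
  have proper: "proper_at_sublevel f tbar \<longleftrightarrow> bounded {x. f x \<le> tbar}"
    using cont lower by (rule proper_at_sublevel_iff_bounded)
  \<comment> \<open>The implications run in the cycle (i), (ii), (iii), (i), and (iv) is linked to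
    (i) in both directions.\<close>
  have "proper_at_sublevel f tbar \<Longrightarrow> palais_smale_at f tbar"
    using bounded_sublevel_no_escaping_sequence[of f tbar]
    unfolding proper palais_smale_at_def K_tilde_inf_def by blast
  moreover have "palais_smale_at f tbar \<Longrightarrow> weak_palais_smale_at f tbar"
    using K_inf_subset_K_tilde_inf unfolding palais_smale_at_def weak_palais_smale_at_def by blast
  moreover have "weak_palais_smale_at f tbar \<Longrightarrow> proper_at_sublevel f tbar"
    using K_inf_nonempty_if_unbounded_sublevel[OF diff lower]
    unfolding proper weak_palais_smale_at_def by blast
  moreover have "proper_at_sublevel f tbar \<Longrightarrow> M_tame_at f tbar"
    using bounded_sublevel_no_escaping_sequence[of f tbar]
    unfolding proper M_tame_at_def T_inf_def by blast
  moreover have "M_tame_at f tbar \<Longrightarrow> proper_at_sublevel f tbar"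
    using T_inf_nonempty_if_unbounded_sublevel[OF diff lower]
    unfolding proper M_tame_at_def by blast
  moreover have "proper_at_sublevel f tbar \<Longrightarrow> closed (sect (range f) tbar)"
    using closed_sect_range[OF cont lower] by blast
  ultimately show ?thesis
    by blast
qed

end
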